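(* Let $\varepsilon\ge0$, $\delta\in[0,1]$, and let $\mathsf{K}:\mathcal{D}\to\mathcal{P}(\mathcal{W})$ be an $(\varepsilon,\delta)$-LDP Markov kernel, where $\mathcal{D}$ and $\mathcal{W}$ are subsets of Euclidean spaces. Let $f:(0,\infty)\to\mathbb{R}$ be convex with $f(1)=0$. Then for all $\mu,\nu\in\mathcal{P}(\mathcal{D})$ with $\mu\ll\nu$, $$D_f(\mu\mathsf{K}\|\nu\mathsf{K})\le\big(1-(1-\delta)e^{-\varepsilon}\big)\,D_f(\mu\|\nu).$$
   Context: $\mathcal{P}(\cdot)$ denotes the set of probability measures on a set. A Markov kernel $\mathsf{K}:\mathcal{D}\to\mathcal{P}(\mathcal{W})$ is $(\varepsilon,\delta)$-LDP if $\sup_{x_1,x_2\in\mathcal{D}}\sup_{A\subset\mathcal{W}}[\mathsf{K}(A|x_1)-e^\varepsilon\mathsf{K}(A|x_2)]\le\delta$, with $A$ ranging over measurable sets. For $\mu\in\mathcal{P}(\mathcal{D})$, $\mu\mathsf{K}=\int\mu(dx)\,\mathsf{K}(\cdot|x)$. For $\mu\ll\nu$, $D_f(\mu\|\nu)=\mathbb{E}_\nu\left[f\left(\frac{d\mu}{d\nu}\right)\right]\in[0,\infty]$, with $f(0)=\lim_{t\to0^+}f(t)$. The convention $0\cdot\infty=0$ is used. *)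

theory Defs
  imports "HOL-Probability.Probability"
begin

text \<open>A subset of a Euclidean space carries its trace Borel sigma-algebra.\<close>

abbreviation borel_on :: "'a::euclidean_space set \<Rightarrow> 'a measure" where
  "borel_on S \<equiv> restrict_space borel S"

abbreviation probs :: "'a::euclidean_space set \<Rightarrow> 'a measure set" where
  "probs S \<equiv> space (prob_algebra (borel_on S))"

abbreviation markov_kernel ::
  "'a::euclidean_space set \<Rightarrow> 'b::euclidean_space set \<Rightarrow> ('a \<Rightarrow> 'b measure) \<Rightarrow> bool" where
  "markov_kernel D W K \<equiv> K \<in> borel_on D \<rightarrow>\<^sub>M prob_algebra (borel_on W)"

text \<open>The suprema are taken in \<^typ>\<open>ereal\<close>, where they always exist.\<close>

definition LDP ::
  "real \<Rightarrow> real \<Rightarrow> 'a::euclidean_space set \<Rightarrow> 'b::euclidean_space set \<Rightarrow> ('a \<Rightarrow> 'b measure) \<Rightarrow> bool" where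
  "LDP \<epsilon> \<delta> D W K \<longleftrightarrow>
     (SUP x\<^sub>1\<in>D. SUP x\<^sub>2\<in>D. SUP A\<in>sets (borel_on W).
        ereal (measure (K x\<^sub>1) A - exp \<epsilon> * measure (K x\<^sub>2) A)) \<le> ereal \<delta>"

text \<open>Extension of \<open>f : (0,\<infinity>) \<rightarrow> \<real>\<close> to \<open>[0,\<infinity>)\<close> by its (possibly infinite) limit at \<open>0\<close>.\<close>

definition ext0 :: "(real \<Rightarrow> real) \<Rightarrow> real \<Rightarrow> ereal" where
  "ext0 f t = (if t = 0 then Lim (at_right 0) (\<lambda>s. ereal (f s)) else ereal (f t))"

text \<open>Expectation of an extended-real function as the integral of the positive part minus the
  integral of the negative part (\<^const>\<open>e2ennreal\<close> truncates negative values to \<open>0\<close>).\<close>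

definition expectation_ereal :: "'a measure \<Rightarrow> ('a \<Rightarrow> ereal) \<Rightarrow> ereal" where
  "expectation_ereal M g =
     enn2ereal (\<integral>\<^sup>+ x. e2ennreal (g x) \<partial>M) - enn2ereal (\<integral>\<^sup>+ x. e2ennreal (- g x) \<partial>M)"

text \<open>Meaningful for probability measures with \<open>\<mu> \<ll> \<nu>\<close> and \<open>f\<close> convex on \<open>(0,\<infinity>)\<close>: then the
  negative part of the integrand is integrable, so \<open>\<infinity> - \<infinity>\<close> does not occur, and \<open>d\<mu>/d\<nu>\<close>, which is
  \<^const>\<open>RN_deriv\<close> with the reference measure as first argument, is finite \<open>\<nu>\<close>-almost everywhere,
  so \<^const>\<open>enn2real\<close> loses nothing.\<close>

definition f_divergence :: "(real \<Rightarrow> real) \<Rightarrow> 'a measure \<Rightarrow> 'a measure \<Rightarrow> ereal" where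
  "f_divergence f \<mu> \<nu> = expectation_ereal \<nu> (\<lambda>x. ext0 f (enn2real (RN_deriv \<nu> \<mu> x)))"

end

theory Submission
  imports Defs
begin

text \<open>The LDP condition bounds the Dobrushin coefficient
  \<open>sup\<^sub>x\<^sub>,\<^sub>y\<^sub>,\<^sub>A (K(A|x) - K(A|y))\<close> by \<open>\<gamma> = 1 - (1 - \<delta>) e\<^sup>-\<^sup>\<epsilon>\<close>. For an affine \<open>l\<close> with
  \<open>l(1) \<le> 0\<close>, put \<open>A = {l(d\<mu>K/d\<nu>K) > 0}\<close> and \<open>i = inf\<^sub>x K(A|x)\<close>. With \<open>\<rho> = d\<mu>/d\<nu>\<close>,
  the integral of the positive part of \<open>l(d\<mu>K/d\<nu>K)\<close> is
  \<open>\<integral> K(A|x) l(\<rho>) d\<nu> = \<integral> (K(A|x) - i) l(\<rho>) d\<nu> + i l(1) \<le> \<gamma> \<integral> l(\<rho>)\<^sup>+ d\<nu>\<close>.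
  After subtracting a multiple of \<open>t - 1\<close>, which does not change the divergence, \<open>f\<close> is nonnegative
  with minimum \<open>f(1) = 0\<close>. It is then a pointwise limit from below of nonnegative combinations of
  such hinge functions \<open>l\<^sup>+\<close>, and Fatou's lemma transfers the contraction to \<open>f\<close>.\<close>

section \<open>Dobrushin coefficient of an LDP kernel\<close>

text \<open>With p and q the two probabilities, the LDP condition gives q \<ge> exp(-\<epsilon>) (p
  - \<delta>). Hence p - q \<le> p (1 - exp(-\<epsilon>)) + \<delta> exp(-\<epsilon>), and p \<le> 1
  yields the bound.\<close>

lemma LDP_imp_measure_diff_le:
  assumes "LDP \<epsilon> \<delta> D W K" and "markov_kernel D W K" and "\<epsilon> \<ge> 0"
    and "x \<in> D" "y \<in> D" and A: "A \<in> sets (borel_on W)"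
  shows "measure (K x) A - measure (K y) A \<le> 1 - (1 - \<delta>) * exp (- \<epsilon>)"
proof -
  have "ereal (measure (K x) A - exp \<epsilon> * measure (K y) A) \<le> ereal \<delta>"
    using assms(1,4-6) by (auto simp: LDP_def SUP_le_iff)
  then have "measure (K x) A - \<delta> \<le> exp \<epsilon> * measure (K y) A"
    by simp
  then have "exp (- \<epsilon>) * (measure (K x) A - \<delta>) \<le> exp (- \<epsilon>) * (exp \<epsilon> * measure (K y) A)"
    by (intro mult_left_mono) auto
  then have *: "exp (- \<epsilon>) * (measure (K x) A - \<delta>) \<le> measure (K y) A"
    by (simp add: mult.assoc[symmetric] exp_add[symmetric])
  have "prob_space (K x)"
    using measurable_space[OF assms(2), of x] \<open>x \<in> D\<close> by (simp add: space_restrict_space space_prob_algebra)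
  then have "measure (K x) A \<le> 1"
    by (rule prob_space.prob_le_1)
  then have "measure (K x) A * (1 - exp (- \<epsilon>)) \<le> 1 * (1 - exp (- \<epsilon>))"
    using \<open>\<epsilon> \<ge> 0\<close> by (intro mult_right_mono) auto
  with * show ?thesis
    by (simp add: algebra_simps)
qed

section \<open>Measures pushed through a kernel and their densities\<close>

text \<open>A set is null for \<open>\<nu> \<bind> K\<close> exactly if it is null for
  \<open>K x\<close> at \<nu>-almost every \<open>x\<close>, and an almost-everywhere statement
  passes from \<nu> to \<mu>.\<close>

lemma absolutely_continuous_bind:
  assumes K: "K \<in> X \<rightarrow>\<^sub>M prob_algebra Y"
    and \<mu>: "\<mu> \<in> space (prob_algebra X)" and \<nu>: "\<nu> \<in> space (prob_algebra X)"
    and ac: "absolutely_continuous \<nu> \<mu>"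
  shows "absolutely_continuous (\<nu> \<bind> K) (\<mu> \<bind> K)"
  unfolding absolutely_continuous_def
proof
  fix A assume A: "A \<in> null_sets (\<nu> \<bind> K)"
  then have AY: "A \<in> sets Y"
    by (auto simp: null_sets_def sets_bind'[OF \<nu> K])
  have sets: "sets \<nu> = sets X" "sets \<mu> = sets X"
    using \<mu> \<nu> by (auto simp: space_prob_algebra)
  have "K \<in> X \<rightarrow>\<^sub>M subprob_algebra Y"
    using K by (rule measurable_prob_algebraD)
  with AY have m: "(\<lambda>x. emeasure (K x) A) \<in> borel_measurable X"
    by measurable
  have "(\<integral>\<^sup>+x. emeasure (K x) A \<partial>\<nu>) = 0"
    using A emeasure_bind_prob_algebra[OF \<nu> K AY] by (simp add: null_sets_def)
  then have "AE x in \<nu>. emeasure (K x) A = 0"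
    using m by (subst (asm) nn_integral_0_iff_AE) (auto simp: measurable_cong_sets[OF sets(1) refl])
  then have "AE x in \<mu>. emeasure (K x) A = 0"
    by (rule absolutely_continuous_AE[rotated 2]) (use ac sets in auto)
  then have "(\<integral>\<^sup>+x. emeasure (K x) A \<partial>\<mu>) = 0"
    using m by (subst nn_integral_0_iff_AE) (auto simp: measurable_cong_sets[OF sets(2) refl])
  then show "A \<in> null_sets (\<mu> \<bind> K)"
    using AY emeasure_bind_prob_algebra[OF \<mu> K AY] by (simp add: null_sets_def sets_bind'[OF \<mu> K])
qed

text \<open>\<open>M\<close> is the reference measure. Everything follows from the change of measure
  \<integral> g dN = \<integral> g (dN/dM) dM, where the bounds on \<open>g\<close> give
  integrability under both measures.\<close>

lemma (in prob_space)
  assumes N: "prob_space N" and ac: "absolutely_continuous M N" and sets: "sets N = sets M"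
  shows integrable_RN_deriv: "integrable M (\<lambda>x. enn2real (RN_deriv M N x))"
    and integral_RN_deriv: "(\<integral>x. enn2real (RN_deriv M N x) \<partial>M) = 1"
    and integrable_mult_affine_RN_deriv: "\<And>g :: 'a \<Rightarrow> real. \<lbrakk>g \<in> borel_measurable M; \<And>x. 0 \<le> g x; \<And>x. g x \<le> 1\<rbrakk> \<Longrightarrow>
          integrable M (\<lambda>x. g x * (a + b * enn2real (RN_deriv M N x)))"
    and integral_mult_affine_RN_deriv: "\<And>g :: 'a \<Rightarrow> real. \<lbrakk>g \<in> borel_measurable M; \<And>x. 0 \<le> g x; \<And>x. g x \<le> 1\<rbrakk> \<Longrightarrow>
          (\<integral>x. g x * (a + b * enn2real (RN_deriv M N x)) \<partial>M) = a * (\<integral>x. g x \<partial>M) + b * (\<integral>x. g x \<partial>N)"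
proof -
  interpret N: prob_space N by fact
  note RN = RN_deriv_integrable[OF N.sigma_finite_measure_axioms ac sets]
    RN_deriv_integral[OF N.sigma_finite_measure_axioms ac sets]
  have int: "integrable N g" "integrable M g"
    if "g \<in> borel_measurable M" "\<And>x. 0 \<le> g x" "\<And>x. g x \<le> 1" for g :: "'a \<Rightarrow> real"
    using that by (auto intro!: integrable_const_bound[of _ 1] N.integrable_const_bound[of _ 1]
        simp: measurable_cong_sets[OF sets refl])
  show "integrable M (\<lambda>x. enn2real (RN_deriv M N x))" "(\<integral>x. enn2real (RN_deriv M N x) \<partial>M) = 1"
    using RN(1)[of "\<lambda>_. 1"] RN(2)[of "\<lambda>_. 1"] by (simp_all add: N.prob_space)
  fix g :: "'a \<Rightarrow> real" assume g: "g \<in> borel_measurable M" "\<And>x. 0 \<le> g x" "\<And>x. g x \<le> 1"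
  have *: "integrable M (\<lambda>x. enn2real (RN_deriv M N x) * g x)"
    using RN(1)[OF g(1)] int[OF g] by simp
  have eq: "(\<lambda>x. g x * (a + b * enn2real (RN_deriv M N x))) = 
    (\<lambda>x. a * g x + b * (enn2real (RN_deriv M N x) * g x))"
    by (auto simp: algebra_simps)
  show "integrable M (\<lambda>x. g x * (a + b * enn2real (RN_deriv M N x)))"
    unfolding eq using * int[OF g] by auto
  show "(\<integral>x. g x * (a + b * enn2real (RN_deriv M N x)) \<partial>M) = a * (\<integral>x. g x \<partial>M) + b * (\<integral>x. g x \<partial>N)"
    unfolding eq using * int[OF g] RN(2)[OF g(1)] by simp
qed

lemma integral_measure_kernel:
  assumes K: "K \<in> X \<rightarrow>\<^sub>M prob_algebra Y" and \<mu>: "\<mu> \<in> space (prob_algebra X)" and A: "A \<in> sets Y"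
  shows "(\<integral>x. measure (K x) A \<partial>\<mu>) = measure (\<mu> \<bind> K) A"
proof -
  have sets: "sets \<mu> = sets X" and "prob_space \<mu>"
    using \<mu> by (auto simp: space_prob_algebra)
  then interpret prob_space \<mu> by simp
  have "K \<in> \<mu> \<rightarrow>\<^sub>M subprob_algebra Y"
    using measurable_prob_algebraD[OF K] by (simp add: measurable_cong_sets[OF sets refl])
  then show ?thesis
    using A by (simp add: measure_bind[where N=Y])
qed

section \<open>Contraction for hinge functions\<close>

lemma affine_positive_part_contraction:
  assumes K: "K \<in> X \<rightarrow>\<^sub>M prob_algebra Y"
    and \<mu>: "\<mu> \<in> space (prob_algebra X)" and \<nu>: "\<nu> \<in> space (prob_algebra X)"
    and ac: "absolutely_continuous \<nu> \<mu>"
    and dob: "\<And>x y A. \<lbrakk>x \<in> space X; y \<in> space X; A \<in> sets Y\<rbrakk> \<Longrightarrow> measure (K x) A - measure (K y) A \<le> \<gamma>"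
    and ab: "a + b \<le> 0"
  shows "(\<integral>\<^sup>+y. ennreal (a + b * enn2real (RN_deriv (\<nu> \<bind> K) (\<mu> \<bind> K) y)) \<partial>(\<nu> \<bind> K))
    \<le> ennreal \<gamma> * (\<integral>\<^sup>+x. ennreal (a + b * enn2real (RN_deriv \<nu> \<mu> x)) \<partial>\<nu>)"
proof -
  let ?P = "\<nu> \<bind> K" and ?Q = "\<mu> \<bind> K"
  define r where "r y = enn2real (RN_deriv ?P ?Q y)" for y
  define \<rho> where "\<rho> x = enn2real (RN_deriv \<nu> \<mu> x)" for x
  have sets: "sets \<nu> = sets X" "sets \<mu> = sets X" "prob_space \<mu>" "prob_space \<nu>"
    using \<mu> \<nu> by (auto simp: space_prob_algebra)
  have space: "space \<nu> = space X" "space \<mu> = space X"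
    using sets_eq_imp_space_eq[OF sets(1)] sets_eq_imp_space_eq[OF sets(2)] .
  have setsP: "sets ?P = sets Y" "sets ?Q = sets Y"
    using sets_bind'[OF _ K] \<mu> \<nu> by auto
  interpret nu: prob_space \<nu> by fact
  interpret P: prob_space ?P by (rule prob_space_bind'[OF \<nu> K])
  interpret Q: prob_space ?Q by (rule prob_space_bind'[OF \<mu> K])
  have acK: "absolutely_continuous ?P ?Q"
    by (rule absolutely_continuous_bind[OF K \<mu> \<nu> ac])
  have r_meas [measurable]: "r \<in> borel_measurable ?P" and \<rho>_meas [measurable]: "\<rho> \<in> borel_measurable \<nu>"
    unfolding r_def \<rho>_def by measurable
  \<comment> \<open>On \<open>A\<close> the positive part is the affine function itself, so its
    integral is linear in the two output measures and pulls back through the kernel.\<close>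
  define A where "A = {y \<in> space ?P. a + b * r y > 0}"
  have A: "A \<in> sets ?P"
    unfolding A_def by measurable
  then have AY: "A \<in> sets Y"
    by (simp add: setsP)
  define k where "k x = measure (K x) A" for x
  have k_meas: "k \<in> borel_measurable \<nu>"
    unfolding k_def using AY measurable_prob_algebraD[OF K]
    by (auto simp: measurable_cong_sets[OF sets(1) refl] intro!: measurable_compose[OF _ measurable_measure_subprob_algebra])
  \<comment> \<open>A point of \<open>X\<close> is needed for \<gamma> \<ge> 0 and for the infimum
    \<open>i\<close> to be over a nonempty set.\<close>
  obtain z where z: "z \<in> space X"
    using nu.not_empty space by auto
  have \<gamma>: "\<gamma> \<ge> 0"
    using dob[OF z z AY] by simp
  have k01: "0 \<le> k x" "k x \<le> 1" if "x \<in> space X" for x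
    using measurable_space[OF K that] by (auto simp: k_def space_prob_algebra prob_space.prob_le_1)
  define i where "i = (INF x\<in>space X. k x)"
  have bdd: "bdd_below (k ` space X)"
    using k01 by (auto intro!: bdd_belowI[of _ 0])
  have i: "i \<le> k x" "k x - i \<le> \<gamma>" if "x \<in> space X" for x
  proof -
    show "i \<le> k x"
      unfolding i_def using bdd that by (rule cINF_lower)
    have "k x - \<gamma> \<le> i"
      unfolding i_def by (rule cINF_greatest) (use z dob[OF that _ AY] in \<open>force simp: k_def\<close>)+
    then show "k x - i \<le> \<gamma>" by simp
  qed
  have i0: "i \<ge> 0"
    unfolding i_def by (rule cINF_greatest) (use z k01 in auto)
  \<comment> \<open>\<open>k\<close> is known to lie between 0 and 1 only on \<open>space X\<close>,
    whereas the integral lemmas for densities ask for these bounds at every point of the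
    type.\<close>
  define k' where "k' x = max 0 (min 1 (k x))" for x
  have k': "k' \<in> borel_measurable \<nu>" "0 \<le> k' x" "k' x \<le> 1" for x
    using k_meas by (auto simp: k'_def[abs_def])
  have k'_eq: "k' x = k x" if "x \<in> space X" for x
    using k01[OF that] by (simp add: k'_def)
  have int_\<rho>: "integrable \<nu> \<rho>" and int_\<rho>_1: "(\<integral>x. \<rho> x \<partial>\<nu>) = 1"
    using nu.integrable_RN_deriv[OF sets(3) ac] nu.integral_RN_deriv[OF sets(3) ac] sets
    by (auto simp: \<rho>_def[abs_def])
  note AP = P.integrable_mult_affine_RN_deriv[OF Q.prob_space_axioms acK, folded r_def]
    P.integral_mult_affine_RN_deriv[OF Q.prob_space_axioms acK, folded r_def]
  note An = nu.integrable_mult_affine_RN_deriv[OF sets(3) ac, folded \<rho>_def]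
    nu.integral_mult_affine_RN_deriv[OF sets(3) ac, folded \<rho>_def]
  have int_k': "integrable \<nu> (\<lambda>x. k' x * (a + b * \<rho> x))"
    by (rule An(1)) (use k' sets in auto)
  have int_i: "integrable \<nu> (\<lambda>x. i * (a + b * \<rho> x))"
    using int_\<rho> by auto
  have pos_int: "integrable \<nu> (\<lambda>x. max 0 (a + b * \<rho> x))"
    using int_\<rho> by auto
  have "(\<integral>\<^sup>+y. ennreal (a + b * r y) \<partial>?P) = (\<integral>\<^sup>+y. ennreal (indicator A y * (a + b * r y)) \<partial>?P)"
    by (rule nn_integral_cong) (auto simp: A_def indicator_def ennreal_neg)
  also have "\<dots> = ennreal (\<integral>y. indicator A y * (a + b * r y) \<partial>?P)"
    using borel_measurable_indicator[OF A]
    by (intro nn_integral_eq_integral AP(1) AE_I2) (auto simp: setsP A_def indicator_def)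
  also have "(\<integral>y. indicator A y * (a + b * r y) \<partial>?P) = a * measure ?P A + b * measure ?Q A"
    using A borel_measurable_indicator[OF A] by (subst AP(2)) (auto simp: setsP)
  also have "\<dots> = a * (\<integral>x. k x \<partial>\<nu>) + b * (\<integral>x. k x \<partial>\<mu>)"
    using integral_measure_kernel[OF K _ AY] \<mu> \<nu> by (simp add: k_def)
  also have "\<dots> = a * (\<integral>x. k' x \<partial>\<nu>) + b * (\<integral>x. k' x \<partial>\<mu>)"
    by (intro arg_cong2[where f="(+)"] arg_cong2[where f="(*)"] refl Bochner_Integration.integral_cong)
      (auto simp: space k'_eq)
  also have "\<dots> = (\<integral>x. k' x * (a + b * \<rho> x) \<partial>\<nu>)"
    by (rule An(2)[symmetric]) (use k' sets in auto)
  also have "\<dots> = (\<integral>x. (k' x - i) * (a + b * \<rho> x) \<partial>\<nu>) + i * (a + b)"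
  proof -
    have "(\<integral>x. (k' x - i) * (a + b * \<rho> x) \<partial>\<nu>) = (\<integral>x. k' x * (a + b * \<rho> x) - i * (a + b * \<rho> x) \<partial>\<nu>)"
      by (simp add: left_diff_distrib)
    also have "\<dots> = (\<integral>x. k' x * (a + b * \<rho> x) \<partial>\<nu>) - (\<integral>x. i * (a + b * \<rho> x) \<partial>\<nu>)"
      by (rule Bochner_Integration.integral_diff[OF int_k' int_i])
    also have "(\<integral>x. i * (a + b * \<rho> x) \<partial>\<nu>) = i * (a + b)"
      using int_\<rho> int_\<rho>_1 by (simp add: nu.prob_space)
    finally show ?thesis by simp
  qed
  also have "\<dots> \<le> (\<integral>x. (k' x - i) * (a + b * \<rho> x) \<partial>\<nu>)"
    using i0 ab by (simp add: mult_nonneg_nonpos)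
  also have "\<dots> \<le> (\<integral>x. \<gamma> * max 0 (a + b * \<rho> x) \<partial>\<nu>)"
  proof (rule integral_mono)
    have "integrable \<nu> (\<lambda>x. k' x * (a + b * \<rho> x) - i * (a + b * \<rho> x))"
      by (rule Bochner_Integration.integrable_diff[OF int_k' int_i])
    then show "integrable \<nu> (\<lambda>x. (k' x - i) * (a + b * \<rho> x))"
      by (simp add: left_diff_distrib)
    show "integrable \<nu> (\<lambda>x. \<gamma> * max 0 (a + b * \<rho> x))"
      using pos_int by simp
    fix x assume "x \<in> space \<nu>"
    then have x: "x \<in> space X" by (simp add: space)
    \<comment> \<open>\<open>k' x - i \<ge> 0\<close> allows the passage to the positive part; only
      then can \<open>k' x - i \<le> \<gamma>\<close> be applied.\<close>
    have "(k' x - i) * (a + b * \<rho> x) \<le> (k' x - i) * max 0 (a + b * \<rho> x)"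
      using i[OF x] k'_eq[OF x] by (intro mult_left_mono) auto
    also have "\<dots> \<le> \<gamma> * max 0 (a + b * \<rho> x)"
      using i[OF x] k'_eq[OF x] by (intro mult_right_mono) auto
    finally show "(k' x - i) * (a + b * \<rho> x) \<le> \<gamma> * max 0 (a + b * \<rho> x)" .
  qed
  also have "\<dots> = \<gamma> * (\<integral>x. max 0 (a + b * \<rho> x) \<partial>\<nu>)"
    by simp
  finally have "(\<integral>\<^sup>+y. ennreal (a + b * r y) \<partial>?P) \<le> ennreal (\<gamma> * (\<integral>x. max 0 (a + b * \<rho> x) \<partial>\<nu>))"
    by (simp add: ennreal_leI)
  also have "\<dots> = ennreal \<gamma> * (\<integral>\<^sup>+x. ennreal (max 0 (a + b * \<rho> x)) \<partial>\<nu>)"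
    using \<gamma> pos_int by (subst nn_integral_eq_integral) (auto simp: ennreal_mult')
  also have "(\<integral>\<^sup>+x. ennreal (max 0 (a + b * \<rho> x)) \<partial>\<nu>) = (\<integral>\<^sup>+x. ennreal (a + b * \<rho> x) \<partial>\<nu>)"
    by (intro nn_integral_cong) (simp add: max_def ennreal_neg)
  finally show ?thesis
    by (simp add: r_def \<rho>_def)
qed

section \<open>Convex functions as sums of hinges\<close>

text \<open>The slope of the piecewise linear interpolation of \<open>a\<close> changes at node
  \<open>k\<close> by the second difference of \<open>a\<close>. Adding up the kinks at the nodes up
  to \<open>m\<close>, with initial slope \<open>a 1\<close>, gives the line through the nodes
  \<open>m\<close> and \<open>m + 1\<close>.\<close>

lemma sum_second_differences_mult:
  fixes a :: "nat \<Rightarrow> real"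
  assumes "a 0 = 0"
  shows "(\<Sum>k\<le>m. (if k = 0 then a 1 else a (k + 1) - 2 * a k + a (k - 1)) * (x - real k))
    = a m + (a (m + 1) - a m) * (x - real m)"
  using assms by (induction m) (simp_all add: algebra_simps)

text \<open>\<open>v\<close> is the convex combination of 0 and \<open>w\<close> with weight
  \<open>v / w\<close> on \<open>w\<close>, so \<open>F v \<le> (v / w) * F w\<close>, and
  \<open>F w \<ge> 0\<close> lets the weight be raised to 1.\<close>

lemma convex_on_mono_from_zero:
  fixes F :: "real \<Rightarrow> real"
  assumes F: "convex_on S F" and "0 \<in> S" "w \<in> S" "F 0 = 0" "F w \<ge> 0" "0 \<le> v" "v \<le> w"
  shows "F v \<le> F w"
proof (cases "w = 0")
  case False
  with assms have w: "w > 0" by simp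
  have "F ((1 - v / w) *\<^sub>R 0 + (v / w) *\<^sub>R w) \<le> (1 - v / w) * F 0 + (v / w) * F w"
    using assms w by (intro convex_onD[OF F]) auto
  then have "F v \<le> (v / w) * F w"
    using w assms by simp
  also have "\<dots> \<le> 1 * F w"
    using assms w by (intro mult_right_mono) auto
  finally show ?thesis by simp
qed (use assms in simp)

text \<open>The middle term is the piecewise linear interpolation of \<open>F\<close> on the grid \<open>h\<nat>\<close>, translated to
  the right by \<open>h\<close>. The translation puts it below \<open>F\<close>, and its coefficients in the hinge functions
  are the second differences of \<open>F\<close>.\<close>

lemma convex_hinge_sandwich:
  fixes F :: "real \<Rightarrow> real" and h :: real
  assumes F: "convex_on S F" and S: "\<And>v w. \<lbrakk>v \<in> S; 0 \<le> w; w \<le> v\<rbrakk> \<Longrightarrow> w \<in> S"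
    and F0: "F 0 = 0" and Fpos: "\<And>v. v \<in> S \<Longrightarrow> F v \<ge> 0" and h: "h > 0"
  obtains c :: "nat \<Rightarrow> real" where "\<And>k. c k \<ge> 0"
    and "\<And>v. \<lbrakk>v \<in> S; v \<ge> 0\<rbrakk> \<Longrightarrow> (\<Sum>k. ennreal (c k * (v / h - real k - 1))) \<le> ennreal (F v)"
    and "\<And>v. \<lbrakk>v \<in> S; v \<ge> 0\<rbrakk> \<Longrightarrow> ennreal (F (max 0 (v - 2 * h))) \<le> (\<Sum>k. ennreal (c k * (v / h - real k - 1)))"
proof
  define a where "a k = F (real k * h)" for k :: nat
  define d where "d k = (if k = 0 then a 1 else a (k + 1) - 2 * a k + a (k - 1))" for k
  \<comment> \<open>Hinge \<open>k\<close> has its kink at \<open>(k + 1) * h\<close>, one node to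
    the right of the node whose second difference it carries. If this point lies outside
    \<open>S\<close>, then \<open>F\<close> is not controlled there, and the hinge vanishes at every
    \<open>v\<close> in \<open>S\<close> anyway.\<close>
  define c where "c k = (if real (k + 1) * h \<in> S then d k else 0)" for k
  have a0: "a 0 = 0" by (simp add: a_def F0)
  show c: "c k \<ge> 0" for k
  proof (cases "real (k + 1) * h \<in> S")
    case True
    show ?thesis
    proof (cases k)
      case 0
      then show ?thesis using True Fpos by (simp add: c_def d_def a_def)
    next
      case (Suc j)
      have j: "real j * h \<in> S"
        by (rule S[OF True]) (use h Suc in \<open>auto intro!: mult_right_mono\<close>)
      have "F ((1 - 1/2) *\<^sub>R (real j * h) + (1/2) *\<^sub>R (real (k + 1) * h))
          \<le> (1 - 1/2) * F (real j * h) + (1/2) * F (real (k + 1) * h)"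
        by (rule convex_onD[OF F]) (use j True in auto)
      also have "(1 - 1/2) *\<^sub>R (real j * h) + (1/2) *\<^sub>R (real (k + 1) * h) = real k * h"
        using Suc by (simp add: algebra_simps)
      finally show ?thesis
        using Suc by (simp add: c_def d_def a_def)
    qed
  qed (simp add: c_def)
  have *: "(\<Sum>k. ennreal (c k * (v / h - real k - 1))) \<le> ennreal (F v) \<and>
      ennreal (F (max 0 (v - 2 * h))) \<le> (\<Sum>k. ennreal (c k * (v / h - real k - 1)))"
    if v: "v \<in> S" "v \<ge> 0" for v
  \<comment> \<open>Below \<open>h\<close> all hinges vanish, and so does
    \<open>F (max 0 (v - 2 * h)) = F 0\<close>.\<close>
  proof (cases "v < h")
    case True
    then have "v / h < 1"
      using h by simp
    then have "v / h - real k - 1 \<le> 0" for k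
      by (simp add: add_increasing)
    then have "ennreal (c k * (v / h - real k - 1)) = 0" for k
      using c[of k] by (intro ennreal_neg mult_nonneg_nonpos)
    then show ?thesis
      using True h by (simp add: F0)
  next
    case False
    then have "v / h \<ge> 1" using h by simp
    \<comment> \<open>\<open>m\<close> is the last hinge whose kink is not to the right of
      \<open>v\<close>: \<open>(m + 1) * h \<le> v < (m + 2) * h\<close>. The relative position of
      \<open>v\<close> in this cell is \<theta>.\<close>
    define m where "m = nat \<lfloor>v / h - 1\<rfloor>"
    have m: "real m \<le> v / h - 1" "v / h - 1 < real m + 1"
      using \<open>v / h \<ge> 1\<close> by (auto simp: m_def)
    define \<theta> where "\<theta> = v / h - 1 - real m"
    have \<theta>: "0 \<le> \<theta>" "\<theta> \<le> 1" using m by (auto simp: \<theta>_def)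
    have mS: "real (k + 1) * h \<in> S" if "k \<le> m" for k
    proof (rule S[OF v(1)])
      have "real (k + 1) \<le> v / h" using that m by simp
      then show "real (k + 1) * h \<le> v" using h by (simp add: field_simps)
    qed (use h in simp)
    have m0S: "real m * h \<in> S"
      by (rule S[OF mS[OF order.refl]]) (use h in auto)
    have zS: "0 \<in> S" by (rule S[OF v(1)]) (use v in auto)
    have "(\<Sum>k. ennreal (c k * (v / h - real k - 1))) = (\<Sum>k\<le>m. ennreal (c k * (v / h - real k - 1)))"
    proof (rule suminf_finite)
      fix k assume "k \<notin> {..m}"
      then have "v / h - real k - 1 \<le> 0" using m by simp
      then show "ennreal (c k * (v / h - real k - 1)) = 0"
        using c[of k] by (intro ennreal_neg mult_nonneg_nonpos)
    qed simp
    also have "\<dots> = ennreal (\<Sum>k\<le>m. c k * (v / h - real k - 1))"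
      using m c by (intro sum_ennreal mult_nonneg_nonneg) auto
    also have "(\<Sum>k\<le>m. c k * (v / h - real k - 1)) = (\<Sum>k\<le>m. d k * ((v / h - 1) - real k))"
      using mS by (intro sum.cong) (auto simp: c_def algebra_simps)
    also have "\<dots> = a m + (a (m + 1) - a m) * \<theta>"
      unfolding d_def \<theta>_def by (rule sum_second_differences_mult[where a = a, OF a0])
    finally have eq: "(\<Sum>k. ennreal (c k * (v / h - real k - 1))) = ennreal (a m + (a (m + 1) - a m) * \<theta>)" .
    \<comment> \<open>Since \<open>v - 2 * h \<le> m * h\<close> and
      \<open>(m + 1) * h \<le> v\<close>, monotonicity of \<open>F\<close> places the interpolated
      value, which lies between \<open>a m\<close> and \<open>a (m + 1)\<close>, between the two
      bounds.\<close>
    have le1: "a m \<le> a (m + 1)"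
      unfolding a_def using mS[of m] zS h F0 Fpos 
      by (intro convex_on_mono_from_zero[OF F]) (auto intro!: mult_right_mono)
    have "real (m + 1) \<le> v / h" using m by simp
    then have "real (m + 1) * h \<le> v" using h by (simp add: field_simps)
    then have le2: "a (m + 1) \<le> F v"
      unfolding a_def using zS h F0 Fpos v
      by (intro convex_on_mono_from_zero[OF F]) auto
    have "v / h \<le> real m + 2" using m by simp
    then have "v - 2 * h \<le> real m * h" using h by (simp add: field_simps)
    then have le3: "F (max 0 (v - 2 * h)) \<le> a m"
      unfolding a_def using zS h F0 Fpos m0S
      by (intro convex_on_mono_from_zero[OF F]) auto
    have "(a (m + 1) - a m) * \<theta> \<le> (a (m + 1) - a m) * 1" "0 \<le> (a (m + 1) - a m) * \<theta>"
      using le1 \<theta> by (intro mult_left_mono mult_nonneg_nonneg; simp)+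
    then show ?thesis
      unfolding eq using le2 le3 by (auto intro!: ennreal_leI)
  qed
  show "\<And>v. \<lbrakk>v \<in> S; v \<ge> 0\<rbrakk> \<Longrightarrow> (\<Sum>k. ennreal (c k * (v / h - real k - 1))) \<le> ennreal (F v)"
    "\<And>v. \<lbrakk>v \<in> S; v \<ge> 0\<rbrakk> \<Longrightarrow> ennreal (F (max 0 (v - 2 * h))) \<le> (\<Sum>k. ennreal (c k * (v / h - real k - 1)))"
    using * by auto
qed

section \<open>From hinges to convex functions on the closed half-line\<close>

text \<open>The kernel enters the rest of the argument only through the hinge inequality, which is
  kept here as an assumption. In the application \<open>P\<close> and \<open>Q\<close> are the
  output and input reference measures, with densities \<open>r\<close> and \<rho>.\<close>

locale affine_contraction =
  fixes P :: "'a measure" and Q :: "'b measure" and r :: "'a \<Rightarrow> real" and \<rho> :: "'b \<Rightarrow> real" and \<gamma> :: real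
  assumes r_measurable [measurable]: "r \<in> borel_measurable P"
    and \<rho>_measurable [measurable]: "\<rho> \<in> borel_measurable Q"
    and r_nonneg: "r y \<ge> 0" and \<rho>_nonneg: "\<rho> x \<ge> 0"
    and affine: "a + b \<le> 0 \<Longrightarrow>
      (\<integral>\<^sup>+y. ennreal (a + b * r y) \<partial>P) \<le> ennreal \<gamma> * (\<integral>\<^sup>+x. ennreal (a + b * \<rho> x) \<partial>Q)"
begin

text \<open>Fatou's lemma bounds the left side by the lower limit of the integrals of
  \<open>u n\<close>; the contraction for each \<open>n\<close> and \<open>u n \<le> g\<close> bound
  these by the right side, which is constant in \<open>n\<close>.\<close>

lemma contraction_liminf:
  fixes g :: "real \<Rightarrow> ennreal" and u :: "nat \<Rightarrow> real \<Rightarrow> ennreal"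
  assumes meas: "\<And>n. (\<lambda>y. u n (r y)) \<in> borel_measurable P"
    and le: "\<And>n t. t \<ge> 0 \<Longrightarrow> u n t \<le> g t"
    and lim: "\<And>t. t \<ge> 0 \<Longrightarrow> g t \<le> liminf (\<lambda>n. u n t)"
    and contr: "\<And>n. (\<integral>\<^sup>+y. u n (r y) \<partial>P) \<le> ennreal \<gamma> * (\<integral>\<^sup>+x. u n (\<rho> x) \<partial>Q)"
  shows "(\<integral>\<^sup>+y. g (r y) \<partial>P) \<le> ennreal \<gamma> * (\<integral>\<^sup>+x. g (\<rho> x) \<partial>Q)"
proof -
  have "(\<integral>\<^sup>+y. g (r y) \<partial>P) \<le> (\<integral>\<^sup>+y. liminf (\<lambda>n. u n (r y)) \<partial>P)"
    by (intro nn_integral_mono lim r_nonneg)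
  also have "\<dots> \<le> liminf (\<lambda>n. \<integral>\<^sup>+y. u n (r y) \<partial>P)"
    by (rule nn_integral_liminf) (rule meas)
  also have "\<dots> \<le> liminf (\<lambda>n::nat. ennreal \<gamma> * (\<integral>\<^sup>+x. g (\<rho> x) \<partial>Q))"
  proof (intro Liminf_mono always_eventually allI)
    fix n
    have "(\<integral>\<^sup>+x. u n (\<rho> x) \<partial>Q) \<le> (\<integral>\<^sup>+x. g (\<rho> x) \<partial>Q)"
      by (intro nn_integral_mono le \<rho>_nonneg)
    then show "(\<integral>\<^sup>+y. u n (r y) \<partial>P) \<le> ennreal \<gamma> * (\<integral>\<^sup>+x. g (\<rho> x) \<partial>Q)"
      using contr[of n] by (meson mult_left_mono order_trans zero_le)
  qed
  also have "\<dots> = ennreal \<gamma> * (\<integral>\<^sup>+x. g (\<rho> x) \<partial>Q)"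
    by (simp add: Liminf_const)
  finally show ?thesis .
qed

text \<open>The sign \<open>e\<close>, used with the values 1 and -1, selects a side of 1:
  \<open>max 0 (e * (t - 1))\<close> is the distance from 1 on that side and 0 on the other.
  \<open>S\<close> holds the distances that occur.\<close>

lemma contraction_one_sided:
  fixes F :: "real \<Rightarrow> real" and e :: real
  assumes F: "convex_on S F" and S: "\<And>v w. \<lbrakk>v \<in> S; 0 \<le> w; w \<le> v\<rbrakk> \<Longrightarrow> w \<in> S"
    and F0: "F 0 = 0" and Fpos: "\<And>v. v \<in> S \<Longrightarrow> F v \<ge> 0" and cont: "continuous_on S F"
    and eS: "\<And>t. t \<ge> 0 \<Longrightarrow> max 0 (e * (t - 1)) \<in> S"
  shows "(\<integral>\<^sup>+y. ennreal (F (max 0 (e * (r y - 1)))) \<partial>P)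
    \<le> ennreal \<gamma> * (\<integral>\<^sup>+x. ennreal (F (max 0 (e * (\<rho> x - 1)))) \<partial>Q)"
proof -
  define h where "h n = inverse (real (Suc n))" for n
  have h: "h n > 0" for n by (simp add: h_def)
  have "\<forall>n. \<exists>c :: nat \<Rightarrow> real. (\<forall>k. c k \<ge> 0) \<and>
    (\<forall>v. v \<in> S \<longrightarrow> v \<ge> 0 \<longrightarrow> (\<Sum>k. ennreal (c k * (v / h n - real k - 1))) \<le> ennreal (F v)) \<and>
    (\<forall>v. v \<in> S \<longrightarrow> v \<ge> 0 \<longrightarrow> ennreal (F (max 0 (v - 2 * h n))) \<le> (\<Sum>k. ennreal (c k * (v / h n - real k - 1))))"
    (is "\<forall>n. ?P n")
  proof
    fix n
    show "?P n"
      by (rule convex_hinge_sandwich[OF F S F0 Fpos h[of n]]) blast+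
  qed
  then obtain c :: "nat \<Rightarrow> nat \<Rightarrow> real" where c: "\<And>n k. c n k \<ge> 0"
    "\<And>n v. v \<in> S \<Longrightarrow> v \<ge> 0 \<Longrightarrow> (\<Sum>k. ennreal (c n k * (v / h n - real k - 1))) \<le> ennreal (F v)"
    "\<And>n v. v \<in> S \<Longrightarrow> v \<ge> 0 \<Longrightarrow> ennreal (F (max 0 (v - 2 * h n))) \<le> (\<Sum>k. ennreal (c n k * (v / h n - real k - 1)))"
    by (atomize_elim, subst (asm) choice_iff) blast
  \<comment> \<open>These are the coefficients of hinge \<open>k\<close> as an affine function of
    \<open>t\<close>. Their sum is \<open>- c n k * (real k + 1) \<le> 0\<close>, as
    \<open>affine\<close> requires.\<close>
  define A where "A n k = - c n k * (e / h n) - c n k * (real k + 1)" for n k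
  define B where "B n k = c n k * (e / h n)" for n k
  define u where "u n t = (\<Sum>k. ennreal (A n k + B n k * t))" for n t
  \<comment> \<open>Truncating \<open>e * (t - 1)\<close> at 0 leaves the hinges unchanged: where it
    is negative, both arguments of \<open>ennreal\<close> are nonpositive.\<close>
  have u: "u n t = (\<Sum>k. ennreal (c n k * (max 0 (e * (t - 1)) / h n - real k - 1)))" for n t
    unfolding u_def
  proof (intro suminf_cong)
    fix k
    have eq: "A n k + B n k * t = c n k * (e * (t - 1) / h n - real k - 1)"
      by (simp add: A_def B_def algebra_simps diff_divide_distrib)
    show "ennreal (A n k + B n k * t) = ennreal (c n k * (max 0 (e * (t - 1)) / h n - real k - 1))"
    proof (cases "e * (t - 1) \<ge> 0")
      case False
      then have "e * (t - 1) / h n \<le> 0" using h[of n] by (simp add: divide_nonpos_pos)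
      with False show ?thesis
        unfolding eq using c(1)[of n k] by (simp add: ennreal_neg mult_nonneg_nonpos)
    qed (simp add: eq)
  qed
  show ?thesis
  proof (rule contraction_liminf[where u = u])
    show "(\<lambda>y. u n (r y)) \<in> borel_measurable P" for n
      unfolding u_def by measurable
    show "u n t \<le> ennreal (F (max 0 (e * (t - 1))))" if "t \<ge> 0" for n t
      unfolding u using eS[OF that] by (intro c(2)) auto
    show "(\<integral>\<^sup>+y. u n (r y) \<partial>P) \<le> ennreal \<gamma> * (\<integral>\<^sup>+x. u n (\<rho> x) \<partial>Q)" for n
    proof -
      have "(\<integral>\<^sup>+y. u n (r y) \<partial>P) = (\<Sum>k. \<integral>\<^sup>+y. ennreal (A n k + B n k * r y) \<partial>P)"
        unfolding u_def by (rule nn_integral_suminf) measurable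
      also have "\<dots> \<le> (\<Sum>k. ennreal \<gamma> * (\<integral>\<^sup>+x. ennreal (A n k + B n k * \<rho> x) \<partial>Q))"
        using c(1) by (intro suminf_le affine) (auto simp: A_def B_def)
      also have "\<dots> = ennreal \<gamma> * (\<Sum>k. \<integral>\<^sup>+x. ennreal (A n k + B n k * \<rho> x) \<partial>Q)"
        by (rule ennreal_suminf_cmult)
      also have "(\<Sum>k. \<integral>\<^sup>+x. ennreal (A n k + B n k * \<rho> x) \<partial>Q) = (\<integral>\<^sup>+x. u n (\<rho> x) \<partial>Q)"
        unfolding u_def by (rule nn_integral_suminf[symmetric]) measurable
      finally show ?thesis .
    qed
    fix t :: real assume t: "t \<ge> 0"
    define v where "v = max 0 (e * (t - 1))"
    have v: "v \<in> S" "v \<ge> 0" using eS[OF t] by (auto simp: v_def)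
    have "(\<lambda>n. max 0 (v - 2 * h n)) \<longlonglongrightarrow> max 0 (v - 2 * 0)"
      unfolding h_def by (intro tendsto_intros LIMSEQ_inverse_real_of_nat)
    then have "(\<lambda>n. max 0 (v - 2 * h n)) \<longlonglongrightarrow> v"
      using v by simp
    moreover have "max 0 (v - 2 * h n) \<in> S" for n
      by (rule S[OF v(1)]) (use v h[of n] in auto)
    ultimately have "(\<lambda>n. F (max 0 (v - 2 * h n))) \<longlonglongrightarrow> F v"
      using v(1) by (intro continuous_on_tendsto_compose[OF cont]) auto
    then have "(\<lambda>n. ennreal (F (max 0 (v - 2 * h n)))) \<longlonglongrightarrow> ennreal (F v)"
      by (rule tendsto_ennrealI)
    then have "ennreal (F v) = liminf (\<lambda>n. ennreal (F (max 0 (v - 2 * h n))))"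
      by (intro lim_imp_Liminf[symmetric]) auto
    also have "\<dots> \<le> liminf (\<lambda>n. u n t)"
      unfolding u v_def[symmetric] using v by (intro Liminf_mono always_eventually allI c(3))
    finally show "ennreal (F (max 0 (e * (t - 1)))) \<le> liminf (\<lambda>n. u n t)"
      by (simp add: v_def)
  qed
qed

text \<open>\<open>g\<close> is cut at its zero 1 into two one-sided functions of the distance from
  1. Their contractions add up, since at each point the half on the other side is evaluated at
  distance 0 and vanishes.\<close>

lemma contraction_convex:
  fixes g :: "real \<Rightarrow> real"
  assumes g: "convex_on {0..} g" and cont: "continuous_on {0..} g"
    and nonneg: "\<And>t. t \<ge> 0 \<Longrightarrow> g t \<ge> 0" and g1: "g 1 = 0"
  shows "(\<integral>\<^sup>+y. ennreal (g (r y)) \<partial>P) \<le> ennreal \<gamma> * (\<integral>\<^sup>+x. ennreal (g (\<rho> x)) \<partial>Q)"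
proof -
  \<comment> \<open>The constant continuation to the left of 0 is continuous on the whole line,
    which gives measurability.\<close>
  define G where "G t = g (max 0 t)" for t
  have [measurable]: "G \<in> borel_measurable borel"
    unfolding G_def
    by (intro borel_measurable_continuous_onI continuous_on_compose2[OF cont]) (auto intro!: continuous_intros)
  define FR where "FR v = G (1 + v)" for v
  define FL where "FL v = G (1 - v)" for v
  have [measurable]: "FR \<in> borel_measurable borel" "FL \<in> borel_measurable borel"
    unfolding FR_def FL_def by measurable
  have R: "(\<integral>\<^sup>+y. ennreal (FR (max 0 (1 * (r y - 1)))) \<partial>P)
    \<le> ennreal \<gamma> * (\<integral>\<^sup>+x. ennreal (FR (max 0 (1 * (\<rho> x - 1)))) \<partial>Q)"
  proof (rule contraction_one_sided[where S = "{0..}"])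
    show "convex_on {0..} FR"
    proof (rule convex_onI)
      fix t x y :: real assume t: "0 < t" "t < 1" and xy: "x \<in> {0..}" "y \<in> {0..}"
      have "g ((1 - t) *\<^sub>R (1 + x) + t *\<^sub>R (1 + y)) \<le> (1 - t) * g (1 + x) + t * g (1 + y)"
        using t xy by (intro convex_onD[OF g]) auto
      moreover have "(1 - t) *\<^sub>R (1 + x) + t *\<^sub>R (1 + y) = 1 + ((1 - t) *\<^sub>R x + t *\<^sub>R y)"
        by (simp add: algebra_simps)
      ultimately show "FR ((1 - t) *\<^sub>R x + t *\<^sub>R y) \<le> (1 - t) * FR x + t * FR y"
        using xy t by (simp add: FR_def G_def max_absorb2)
    qed simp
    show "continuous_on {0..} FR"
      unfolding FR_def G_def
      by (intro continuous_on_compose2[OF cont]) (auto intro!: continuous_intros)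
  qed (use nonneg g1 in \<open>auto simp: FR_def G_def\<close>)
  have L: "(\<integral>\<^sup>+y. ennreal (FL (max 0 (- 1 * (r y - 1)))) \<partial>P)
    \<le> ennreal \<gamma> * (\<integral>\<^sup>+x. ennreal (FL (max 0 (- 1 * (\<rho> x - 1)))) \<partial>Q)"
  \<comment> \<open>To the left of 1 the distance is at most 1 because \<open>t \<ge> 0\<close>.
    Beyond distance 1, \<open>FL\<close> is constant and convexity can fail.\<close>
  proof (rule contraction_one_sided[where S = "{0..1}"])
    show "convex_on {0..1} FL"
    proof (rule convex_onI)
      fix t x y :: real assume t: "0 < t" "t < 1" and xy: "x \<in> {0..1}" "y \<in> {0..1}"
      have "g ((1 - t) *\<^sub>R (1 - x) + t *\<^sub>R (1 - y)) \<le> (1 - t) * g (1 - x) + t * g (1 - y)"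
        using t xy by (intro convex_onD[OF g]) auto
      moreover have "(1 - t) *\<^sub>R (1 - x) + t *\<^sub>R (1 - y) = 1 - ((1 - t) *\<^sub>R x + t *\<^sub>R y)"
        by (simp add: algebra_simps)
      moreover have "(1 - t) * x + t * y \<le> (1 - t) * 1 + t * 1"
        using t xy by (intro add_mono mult_left_mono) auto
      ultimately show "FL ((1 - t) *\<^sub>R x + t *\<^sub>R y) \<le> (1 - t) * FL x + t * FL y"
        using xy t by (simp add: FL_def G_def max_absorb2)
    qed simp
    show "continuous_on {0..1} FL"
      unfolding FL_def G_def
      by (intro continuous_on_compose2[OF cont]) (auto intro!: continuous_intros)
  qed (use nonneg g1 in \<open>auto simp: FL_def G_def\<close>)
  have split: "ennreal (g t) = ennreal (FR (max 0 (1 * (t - 1)))) + ennreal (FL (max 0 (- 1 * (t - 1))))"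
    if "t \<ge> 0" for t
    using that g1 by (cases "t \<ge> 1") (auto simp: FR_def FL_def G_def max_def)
  have "(\<integral>\<^sup>+y. ennreal (g (r y)) \<partial>P) =
    (\<integral>\<^sup>+y. ennreal (FR (max 0 (1 * (r y - 1)))) \<partial>P) + (\<integral>\<^sup>+y. ennreal (FL (max 0 (- 1 * (r y - 1)))) \<partial>P)"
    unfolding split[OF r_nonneg] by (rule nn_integral_add) measurable
  also have "\<dots> \<le> ennreal \<gamma> * (\<integral>\<^sup>+x. ennreal (FR (max 0 (1 * (\<rho> x - 1)))) \<partial>Q) +
      ennreal \<gamma> * (\<integral>\<^sup>+x. ennreal (FL (max 0 (- 1 * (\<rho> x - 1)))) \<partial>Q)"
    by (rule add_mono[OF R L])
  also have "\<dots> = ennreal \<gamma> * (\<integral>\<^sup>+x. ennreal (g (\<rho> x)) \<partial>Q)"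
    unfolding split[OF \<rho>_nonneg] distrib_left[symmetric] 
    by (subst nn_integral_add[symmetric]) measurable
  finally show ?thesis .
qed

end

section \<open>The divergence as a nonnegative integral\<close>

text \<open>As \<open>h\<close> may be infinite, the identity (h + g)^+ + g^- = (h + g)^- + h + g^+
  is integrated without subtraction. The integrals of g^+ and g^- are finite and equal, so they
  cancel.\<close>

lemma expectation_ereal_add_centered:
  fixes g :: "'a \<Rightarrow> real"
  assumes [measurable]: "h \<in> borel_measurable M" and h: "\<And>x. h x \<ge> 0"
    and g: "integrable M g" "(\<integral>x. g x \<partial>M) = 0"
  shows "expectation_ereal M (\<lambda>x. h x + ereal (g x)) = enn2ereal (\<integral>\<^sup>+x. e2ennreal (h x) \<partial>M)"
proof -
  have [measurable]: "g \<in> borel_measurable M"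
    using g by auto
  define Pos where "Pos = (\<integral>\<^sup>+x. e2ennreal (h x + ereal (g x)) \<partial>M)"
  define Neg where "Neg = (\<integral>\<^sup>+x. e2ennreal (- (h x + ereal (g x))) \<partial>M)"
  define H where "H = (\<integral>\<^sup>+x. e2ennreal (h x) \<partial>M)"
  define Gp where "Gp = (\<integral>\<^sup>+x. ennreal (g x) \<partial>M)"
  define Gm where "Gm = (\<integral>\<^sup>+x. ennreal (- g x) \<partial>M)"
  have fin: "Gp < \<infinity>" "Gm < \<infinity>"
    using g(1) unfolding real_integrable_def Gp_def Gm_def by (auto simp: less_top)
  have "enn2real Gp = enn2real Gm"
    using g real_lebesgue_integral_def[OF g(1)] by (simp add: Gp_def Gm_def)
  then have G: "Gp = Gm"
    using fin by (metis ennreal_enn2real infinity_ennreal_def)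
  have pw: "e2ennreal (h x + ereal (g x)) + ennreal (- g x)
      = e2ennreal (- (h x + ereal (g x))) + e2ennreal (h x) + ennreal (g x)" for x
  proof (cases "h x")
    case (real y)
    then have "y \<ge> 0" using h[of x] by simp
    with real show ?thesis
      by (cases "g x \<ge> 0"; cases "y + g x \<ge> 0")
        (auto simp: ennreal_neg ennreal_plus[symmetric] simp del: ennreal_plus)
  qed (use h[of x] in auto)
  have "Pos + Gm = (\<integral>\<^sup>+x. e2ennreal (h x + ereal (g x)) + ennreal (- g x) \<partial>M)"
    unfolding Pos_def Gm_def by (rule nn_integral_add[symmetric]) measurable
  also have "\<dots> = Neg + H + Gp"
    unfolding pw Neg_def H_def Gp_def by (subst nn_integral_add; (measurable)?)+
  finally have "Gm + Pos = Gm + (Neg + H)"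
    by (simp add: G ac_simps)
  then have eq: "Pos = Neg + H"
    using fin by (auto simp: ennreal_add_left_cancel)
  \<comment> \<open>Since \<open>h \<ge> 0\<close>, \<open>Neg\<close> is finite, so the difference
    of \<open>Pos\<close> and \<open>Neg\<close> is meaningful even if \<open>H\<close> is
    infinite.\<close>
  have "Neg \<le> Gm"
    unfolding Neg_def Gm_def
  proof (rule nn_integral_mono)
    fix x
    have "- (h x + ereal (g x)) \<le> ereal (- g x)"
      using h[of x] by (cases "h x") auto
    then show "e2ennreal (- (h x + ereal (g x))) \<le> ennreal (- g x)"
      using e2ennreal_mono by force
  qed
  then have "Neg < \<infinity>"
    using fin by (auto intro: le_less_trans)
  then obtain n where n: "Neg = ennreal n" "n \<ge> 0"
    by (cases Neg) auto
  have "enn2ereal Pos - enn2ereal Neg = enn2ereal H"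
    unfolding eq plus_ennreal.rep_eq n using n by (cases H) (auto simp: enn2ereal_ennreal)
  then show ?thesis
    by (simp add: expectation_ereal_def Pos_def Neg_def H_def)
qed

text \<open>\<open>t\<close> is a convex combination of \<open>s\<close> and 1 with some weight
  \<theta> on \<open>s\<close>, so \<open>f t \<le> \<theta> * f s \<le> f s\<close> because
  \<open>f 1 = 0\<close> and \<open>f s \<ge> 0\<close>.\<close>

lemma convex_on_nonneg_antimono:
  fixes f :: "real \<Rightarrow> real"
  assumes f: "convex_on {0<..} f" and pos: "\<And>t. t > 0 \<Longrightarrow> f t \<ge> 0" and f1: "f 1 = 0"
    and t: "0 < s" "s \<le> t" "t \<le> 1"
  shows "f t \<le> f s"
proof (cases "s = 1")
  case False
  with t have s: "s < 1" by simp
  define \<theta> where "\<theta> = (1 - t) / (1 - s)"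
  have \<theta>: "0 \<le> \<theta>" "\<theta> \<le> 1" using t s by (auto simp: \<theta>_def)
  have "\<theta> * (1 - s) = 1 - t"
    using s by (simp add: \<theta>_def)
  then have "(1 - \<theta>) *\<^sub>R 1 + \<theta> *\<^sub>R s = t"
    by (simp add: algebra_simps)
  moreover have "f ((1 - \<theta>) *\<^sub>R 1 + \<theta> *\<^sub>R s) \<le> (1 - \<theta>) * f 1 + \<theta> * f s"
    using t \<theta> by (intro convex_onD[OF f]) auto
  ultimately have "f t \<le> \<theta> * f s" by (simp add: f1)
  also have "\<dots> \<le> 1 * f s"
    using \<theta> pos[of s] t by (intro mult_right_mono) auto
  finally show ?thesis by simp
qed (use t in simp)

text \<open>As \<open>f\<close> decreases on (0,1], its limit at 0 exists in \<open>ereal\<close> as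
  a supremum. So \<open>Lim\<close> in \<open>ext0\<close> denotes a genuine, possibly infinite,
  limit.\<close>

lemma
  fixes f :: "real \<Rightarrow> real"
  assumes f: "convex_on {0<..} f" and pos: "\<And>t. t > 0 \<Longrightarrow> f t \<ge> 0" and f1: "f 1 = 0"
  shows tendsto_ext0: "((\<lambda>s. ereal (f s)) \<longlongrightarrow> ext0 f 0) (at_right 0)"
    and le_ext0: "\<And>s. 0 < s \<Longrightarrow> s < 1 \<Longrightarrow> ereal (f s) \<le> ext0 f 0"
proof -
  define L where "L = (SUP s\<in>{0<..<1}. ereal (f s))"
  have le: "ereal (f s) \<le> L" if "0 < s" "s < 1" for s
    unfolding L_def using that by (intro SUP_upper) auto
  have lim: "((\<lambda>s. ereal (f s)) \<longlongrightarrow> L) (at_right 0)"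
  proof (rule order_tendstoI)
    fix a assume "a < L"
    then obtain s where s: "0 < s" "s < 1" "a < ereal (f s)"
      by (auto simp: L_def less_SUP_iff)
    have "a < ereal (f t)" if "0 < t" "t < s" for t
      using convex_on_nonneg_antimono[OF f pos f1, of t s] s that by (auto intro: less_le_trans)
    then show "\<forall>\<^sub>F t in at_right 0. a < ereal (f t)"
      using s by (auto simp: eventually_at_right_field)
  next
    fix a assume "L < a"
    then show "\<forall>\<^sub>F t in at_right 0. ereal (f t) < a"
      using le by (auto simp: eventually_at_right_field intro!: exI[of _ 1] intro: le_less_trans)
  qed
  then have L: "ext0 f 0 = L"
    unfolding ext0_def by (auto intro!: tendsto_Lim)
  show "((\<lambda>s. ereal (f s)) \<longlongrightarrow> ext0 f 0) (at_right 0)"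
    using lim by (simp add: L)
  show "\<And>s. 0 < s \<Longrightarrow> s < 1 \<Longrightarrow> ereal (f s) \<le> ext0 f 0"
    using le by (simp add: L)
qed

lemma ext0_nonneg:
  fixes f :: "real \<Rightarrow> real"
  assumes f: "convex_on {0<..} f" and pos: "\<And>t. t > 0 \<Longrightarrow> f t \<ge> 0" and f1: "f 1 = 0" and "t \<ge> 0"
  shows "ext0 f t \<ge> 0"
proof (cases "t = 0")
  case True
  have "0 \<le> ereal (f (1/2))" using pos[of "1/2"] by simp
  also have "\<dots> \<le> ext0 f 0" by (rule le_ext0[OF f pos f1]) auto
  finally show ?thesis using True by simp
qed (use assms in \<open>simp add: ext0_def\<close>)

lemma ext0_add_affine:
  fixes f :: "real \<Rightarrow> real"
  assumes f: "convex_on {0<..} f" and pos: "\<And>t. t > 0 \<Longrightarrow> f t \<ge> 0" and f1: "f 1 = 0" and "t \<ge> 0"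
  shows "ext0 (\<lambda>t. f t + c * (t - 1)) t = ext0 f t + ereal (c * (t - 1))"
proof (cases "t = 0")
  case True
  have lim: "((\<lambda>s. ereal (c * (s - 1))) \<longlongrightarrow> ereal (c * (0 - 1))) (at_right 0)"
    by (intro tendsto_intros)
  \<comment> \<open>The affine term has a finite limit, so the limits may be added even if
    \<open>ext0 f 0\<close> is infinite.\<close>
  have "((\<lambda>s. ereal (f s) + ereal (c * (s - 1))) \<longlongrightarrow> ext0 f 0 + ereal (c * (0 - 1))) (at_right 0)"
    by (rule tendsto_add_ereal_general1[OF _ tendsto_ext0[OF f pos f1] lim]) auto
  then have "((\<lambda>s. ereal (f s + c * (s - 1))) \<longlongrightarrow> ext0 f 0 + ereal (c * (0 - 1))) (at_right 0)"
    by simp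
  then have "Lim (at_right 0) (\<lambda>s. ereal (f s + c * (s - 1))) = ext0 f 0 + ereal (c * (0 - 1))"
    by (intro tendsto_Lim) auto
  then show ?thesis
    by (simp add: True ext0_def[of "\<lambda>t. f t + c * (t - 1)"])
qed (use assms in \<open>simp add: ext0_def\<close>)

text \<open>The term \<open>c * (t - 1)\<close> integrates to 0 because a density has integral 1.
  The sum form on the left fits any convex function that is split into a nonnegative part and a
  supporting line at 1.\<close>

lemma f_divergence_convex_eq_nn_integral:
  fixes f :: "real \<Rightarrow> real"
  assumes M: "prob_space M" and N: "prob_space N" and ac: "absolutely_continuous M N" and sets: "sets N = sets M"
    and f: "convex_on {0<..} f" and pos: "\<And>t. t > 0 \<Longrightarrow> f t \<ge> 0" and f1: "f 1 = 0"
  shows "f_divergence (\<lambda>t. f t + c * (t - 1)) N M =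
    enn2ereal (\<integral>\<^sup>+x. e2ennreal (ext0 f (enn2real (RN_deriv M N x))) \<partial>M)"
proof -
  interpret M: prob_space M by fact
  define \<rho> where "\<rho> x = enn2real (RN_deriv M N x)" for x
  have \<rho>: "\<rho> x \<ge> 0" for x by (simp add: \<rho>_def)
  have int: "integrable M \<rho>" "(\<integral>x. \<rho> x \<partial>M) = 1"
    unfolding \<rho>_def using M.integrable_RN_deriv[OF N ac sets] M.integral_RN_deriv[OF N ac sets] by auto
  have [measurable]: "\<rho> \<in> borel_measurable M" using int by auto
  have "continuous_on {0<..} f"
    by (rule convex_on_continuous[OF _ f]) simp
  \<comment> \<open>\<open>f\<close> is arbitrary on the nonpositive reals, so it is cut off there
    to be Borel; the value of \<open>ext0\<close> at 0 is treated as a separate constant.\<close>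
  then have [measurable]: "(\<lambda>t. if t \<in> {0<..} then f t else 0) \<in> borel_measurable borel"
    by (intro borel_measurable_continuous_on_if) auto
  have eq: "ext0 f (\<rho> x) = (if \<rho> x = 0 then ext0 f 0 else ereal ((\<lambda>t. if t \<in> {0<..} then f t else 0) (\<rho> x)))" for x
    using \<rho>[of x] by (simp add: ext0_def)
  have "(\<lambda>x. ext0 f (\<rho> x)) \<in> borel_measurable M"
    unfolding eq by measurable
  moreover have "integrable M (\<lambda>x. c * (\<rho> x - 1))" "(\<integral>x. c * (\<rho> x - 1) \<partial>M) = 0"
    using int by (auto simp: M.prob_space)
  ultimately have "expectation_ereal M (\<lambda>x. ext0 f (\<rho> x) + ereal (c * (\<rho> x - 1)))
      = enn2ereal (\<integral>\<^sup>+x. e2ennreal (ext0 f (\<rho> x)) \<partial>M)"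
    by (intro expectation_ereal_add_centered ext0_nonneg[OF f pos f1 \<rho>])
  moreover have "ext0 (\<lambda>t. f t + c * (t - 1)) (\<rho> x) = ext0 f (\<rho> x) + ereal (c * (\<rho> x - 1))" for x
    by (rule ext0_add_affine[OF f pos f1 \<rho>])
  ultimately show ?thesis
    by (simp add: f_divergence_def \<rho>_def)
qed

section \<open>Contraction with a possible singularity at 0\<close>

text \<open>\<open>contraction_convex\<close> needs a finite continuous function on the closed
  half-line, while \<open>ext0 f 0\<close> may be infinite. It is therefore applied to
  approximations of \<open>f\<close> from below, which converge pointwise.\<close>

lemma (in affine_contraction) contraction_ext0:
  fixes f :: "real \<Rightarrow> real"
  assumes f: "convex_on {0<..} f" and pos: "\<And>t. t > 0 \<Longrightarrow> f t \<ge> 0" and f1: "f 1 = 0"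
  shows "(\<integral>\<^sup>+y. e2ennreal (ext0 f (r y)) \<partial>P) \<le> ennreal \<gamma> * (\<integral>\<^sup>+x. e2ennreal (ext0 f (\<rho> x)) \<partial>Q)"
proof -
  define h where "h n = inverse (real (Suc n))" for n
  have h: "h n > 0" for n by (simp add: h_def)
  \<comment> \<open>Shrinking the argument towards \<open>1\<close> removes the possible singularity at \<open>0\<close> and, by
    convexity, only decreases \<open>f\<close>.\<close>
  define u where "u n t = (t + h n) / (1 + h n)" for n t
  have u_pos: "u n t > 0" if "t \<ge> 0" for n t
    using that h[of n] by (simp add: u_def)
  have u_conv: "u n t = (1 - h n / (1 + h n)) *\<^sub>R t + (h n / (1 + h n)) *\<^sub>R 1" for n t
  proof -
    have "1 - h n / (1 + h n) = 1 / (1 + h n)"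
      using h[of n] by (simp add: field_simps)
    then show ?thesis
      by (simp add: u_def add_divide_distrib)
  qed
  have u_cont: "continuous_on A (u n)" for A n
    unfolding u_def using h[of n] by (intro continuous_intros) auto
  have u_lim: "(\<lambda>n. u n t) \<longlonglongrightarrow> t" for t
  proof -
    have "h \<longlonglongrightarrow> 0"
      unfolding h_def by (rule LIMSEQ_inverse_real_of_nat)
    then have "(\<lambda>n. u n t) \<longlonglongrightarrow> (t + 0) / (1 + 0)"
      unfolding u_def by (intro tendsto_intros) auto
    then show ?thesis by simp
  qed
  have cont: "continuous_on {0<..} f"
    by (rule convex_on_continuous[OF _ f]) simp
  have cont_u: "continuous_on {0..} (\<lambda>t. f (u n t))" for n
    by (rule continuous_on_compose2[OF cont u_cont]) (use u_pos in auto)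
  show ?thesis
  proof (rule contraction_liminf[where u = "\<lambda>n t. ennreal (f (u n t))"])
    fix n
    have "continuous_on UNIV (\<lambda>t. f (u n (max 0 t)))"
      by (rule continuous_on_compose2[OF cont_u]) (auto intro!: continuous_intros)
    then have [measurable]: "(\<lambda>t. f (u n (max 0 t))) \<in> borel_measurable borel"
      by (rule borel_measurable_continuous_onI)
    have "(\<lambda>y. ennreal (f (u n (max 0 (r y))))) \<in> borel_measurable P"
      by measurable
    then show "(\<lambda>y. ennreal (f (u n (r y)))) \<in> borel_measurable P"
      by (simp add: max_absorb2 r_nonneg)
    show "(\<integral>\<^sup>+y. ennreal (f (u n (r y))) \<partial>P) \<le> ennreal \<gamma> * (\<integral>\<^sup>+x. ennreal (f (u n (\<rho> x))) \<partial>Q)"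
    proof (rule contraction_convex[OF _ cont_u])
      show "convex_on {0..} (\<lambda>t. f (u n t))"
      proof (rule convex_onI)
        fix s x y :: real assume s: "0 < s" "s < 1" and xy: "x \<in> {0..}" "y \<in> {0..}"
        have "u n ((1 - s) *\<^sub>R x + s *\<^sub>R y) = (1 - s) *\<^sub>R u n x + s *\<^sub>R u n y"
          by (simp add: u_def add_divide_distrib[symmetric] algebra_simps)
        then show "f (u n ((1 - s) *\<^sub>R x + s *\<^sub>R y)) \<le> (1 - s) * f (u n x) + s * f (u n y)"
          using convex_onD[OF f, of s "u n x" "u n y"] s xy u_pos by simp
      qed simp
      show "f (u n t) \<ge> 0" if "t \<ge> 0" for t
        using pos u_pos[OF that] by simp
      show "f (u n 1) = 0"
        using h[of n] f1 by (simp add: u_def)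
    qed
  next
    fix n and t :: real assume t: "t \<ge> 0"
    have "ereal (f (u n t)) \<le> ext0 f t"
    proof (cases "t = 0")
      case True
      \<comment> \<open>At 0 the bound comes from \<open>u n 0\<close> lying in (0,1), where
        \<open>f\<close> stays below its limit at 0.\<close>
      have "u n 0 < 1" using h[of n] by (simp add: u_def)
      then show ?thesis
        using True le_ext0[OF f pos f1, of "u n 0"] u_pos by simp
    next
      case False
      then have t: "t > 0" using t by simp
      define s where "s = h n / (1 + h n)"
      have s: "0 \<le> s" "s \<le> 1" using h[of n] by (auto simp: s_def)
      have "f (u n t) \<le> (1 - s) * f t + s * f 1"
        unfolding u_conv s_def[symmetric] using s t by (intro convex_onD[OF f]) auto
      also have "\<dots> \<le> 1 * f t"
        using s pos[OF t] f1 by (simp add: mult_left_le_one_le)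
      finally show ?thesis using t by (simp add: ext0_def)
    qed
    then show "ennreal (f (u n t)) \<le> e2ennreal (ext0 f t)"
      using e2ennreal_mono by force
  next
    fix t :: real assume t: "t \<ge> 0"
    have "(\<lambda>n. ereal (f (u n t))) \<longlonglongrightarrow> ext0 f t"
    proof (cases "t = 0")
      case True
      \<comment> \<open>\<open>u n 0\<close> tends to 0 through positive values, so the one-sided
        limit defining \<open>ext0 f 0\<close> applies.\<close>
      have "filterlim (\<lambda>n. u n 0) (at_right 0) sequentially"
        using u_lim[of 0] u_pos[of 0] less_imp_neq[OF u_pos[of 0]]
        by (auto simp: filterlim_at)
      from filterlim_compose[OF tendsto_ext0[OF f pos f1] this] show ?thesis
        using True by simp
    next
      case False
      then have "(\<lambda>n. f (u n t)) \<longlonglongrightarrow> f t"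
        using t u_pos u_lim[of t] by (intro continuous_on_tendsto_compose[OF cont]) auto
      then show ?thesis using False by (simp add: ext0_def)
    qed
    then have "(\<lambda>n. e2ennreal (ereal (f (u n t)))) \<longlonglongrightarrow> e2ennreal (ext0 f t)"
      by (rule tendsto_e2ennrealI)
    then show "e2ennreal (ext0 f t) \<le> liminf (\<lambda>n. ennreal (f (u n t)))"
      by (simp add: lim_imp_Liminf)
  qed
qed

section \<open>Normalisation by a supporting line, and conclusion\<close>

theorem mainTheorem4:
  fixes D :: "'a::euclidean_space set" and W :: "'b::euclidean_space set"
    and K :: "'a \<Rightarrow> 'b measure"
    and \<epsilon> \<delta> :: real
    and f :: "real \<Rightarrow> real"
  assumes "\<epsilon> \<ge> 0" and "\<delta> \<in> {0..1}"
    and "markov_kernel D W K"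
    and "LDP \<epsilon> \<delta> D W K"
    and "convex_on {0<..} f" and "f 1 = 0"
  shows "\<forall>\<mu>\<in>probs D. \<forall>\<nu>\<in>probs D. absolutely_continuous \<nu> \<mu> \<longrightarrow>
           f_divergence f (\<mu> \<bind> K) (\<nu> \<bind> K)
             \<le> ereal (1 - (1 - \<delta>) * exp (- \<epsilon>)) * f_divergence f \<mu> \<nu>"
proof (intro ballI impI)
  note K = assms(3)
  fix \<mu> \<nu> assume \<mu>: "\<mu> \<in> probs D" and \<nu>: "\<nu> \<in> probs D" and ac: "absolutely_continuous \<nu> \<mu>"
  define \<gamma> where "\<gamma> = 1 - (1 - \<delta>) * exp (- \<epsilon>)"
  \<comment> \<open>Nonnegativity of \<gamma> lets the factor move from \<open>ennreal\<close> to
    \<open>ereal\<close> at the end.\<close>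
  have "(1 - \<delta>) * exp (- \<epsilon>) \<le> 1 * 1"
    using assms(1,2) by (intro mult_mono) auto
  then have \<gamma>: "\<gamma> \<ge> 0" by (simp add: \<gamma>_def)
  \<comment> \<open>The infimum of the secant slopes to the right of 1 is a subgradient of
    \<open>f\<close> at 1.\<close>
  define c where "c = Inf ((\<lambda>t. (f 1 - f t) / (1 - t)) ` ({1<..} \<inter> {0<..}))"
  define g where "g t = f t - c * (t - 1)" for t
  have sub: "c * (t - 1) \<le> f t" if "t > 0" for t
    using convex_le_Inf_differential[OF assms(5), of 1 t] that assms(6) by (simp add: c_def interior_open)
  have g: "convex_on {0<..} g"
  proof (rule convex_onI)
    fix t x y :: real assume "0 < t" "t < 1" "x \<in> {0<..}" "y \<in> {0<..}"
    then show "g ((1 - t) *\<^sub>R x + t *\<^sub>R y) \<le> (1 - t) * g x + t * g y"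
      using convex_onD[OF assms(5), of t x y] by (simp add: g_def algebra_simps)
  qed simp
  have g_pos: "\<And>t. t > 0 \<Longrightarrow> g t \<ge> 0" and g1: "g 1 = 0"
    using sub assms(6) by (auto simp: g_def)
  \<comment> \<open>The same \<open>c\<close> serves the divergences before and after the kernel, so
    both become integrals of \<open>ext0 g\<close>.\<close>
  have f_eq: "f = (\<lambda>t. g t + c * (t - 1))"
    by (simp add: g_def)
  have ps: "prob_space \<mu>" "prob_space \<nu>" "sets \<mu> = sets \<nu>"
    using \<mu> \<nu> by (auto simp: space_prob_algebra)
  have psK: "prob_space (\<mu> \<bind> K)" "prob_space (\<nu> \<bind> K)" "sets (\<mu> \<bind> K) = sets (\<nu> \<bind> K)"
    using prob_space_bind'[OF \<mu> K] prob_space_bind'[OF \<nu> K] sets_bind'[OF \<mu> K] sets_bind'[OF \<nu> K] by auto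
  have acK: "absolutely_continuous (\<nu> \<bind> K) (\<mu> \<bind> K)"
    by (rule absolutely_continuous_bind[OF K \<mu> \<nu> ac])
  define r where "r y = enn2real (RN_deriv (\<nu> \<bind> K) (\<mu> \<bind> K) y)" for y
  define \<rho> where "\<rho> x = enn2real (RN_deriv \<nu> \<mu> x)" for x
  interpret affine_contraction "\<nu> \<bind> K" \<nu> r \<rho> \<gamma>
  proof
    show "r \<in> borel_measurable (\<nu> \<bind> K)" "\<rho> \<in> borel_measurable \<nu>"
      unfolding r_def \<rho>_def by measurable
    show "0 \<le> r y" "0 \<le> \<rho> x" for x y
      by (simp_all add: r_def \<rho>_def)
    fix a b :: real assume ab: "a + b \<le> 0"
    show "(\<integral>\<^sup>+y. ennreal (a + b * r y) \<partial>(\<nu> \<bind> K)) \<le> ennreal \<gamma> * (\<integral>\<^sup>+x. ennreal (a + b * \<rho> x) \<partial>\<nu>)"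
      unfolding r_def \<rho>_def
    proof (rule affine_positive_part_contraction[OF K \<mu> \<nu> ac _ ab])
      fix x y A assume "x \<in> space (borel_on D)" "y \<in> space (borel_on D)" "A \<in> sets (borel_on W)"
      then show "measure (K x) A - measure (K y) A \<le> \<gamma>"
        unfolding \<gamma>_def using LDP_imp_measure_diff_le[OF assms(4,3,1)] by (simp add: space_restrict_space)
    qed
  qed
  have "f_divergence f (\<mu> \<bind> K) (\<nu> \<bind> K) = enn2ereal (\<integral>\<^sup>+y. e2ennreal (ext0 g (r y)) \<partial>(\<nu> \<bind> K))"
    unfolding f_eq r_def by (rule f_divergence_convex_eq_nn_integral[OF psK(2,1) acK psK(3) g g_pos g1])
  also have "\<dots> \<le> enn2ereal (ennreal \<gamma> * (\<integral>\<^sup>+x. e2ennreal (ext0 g (\<rho> x)) \<partial>\<nu>))"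
    using contraction_ext0[OF g g_pos g1] by (simp add: less_eq_ennreal.rep_eq)
  also have "\<dots> = ereal \<gamma> * enn2ereal (\<integral>\<^sup>+x. e2ennreal (ext0 g (\<rho> x)) \<partial>\<nu>)"
    using \<gamma> by (simp add: times_ennreal.rep_eq enn2ereal_ennreal)
  also have "enn2ereal (\<integral>\<^sup>+x. e2ennreal (ext0 g (\<rho> x)) \<partial>\<nu>) = f_divergence f \<mu> \<nu>"
    unfolding f_eq \<rho>_def by (rule f_divergence_convex_eq_nn_integral[OF ps(2,1) ac ps(3) g g_pos g1, symmetric])
  finally show "f_divergence f (\<mu> \<bind> K) (\<nu> \<bind> K) \<le> ereal (1 - (1 - \<delta>) * exp (- \<epsilon>)) * f_divergence f \<mu> \<nu>"
    by (simp add: \<gamma>_def)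
qed

end
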